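(* Let $G$ be a graph and let $m$ and $n$ be monomials in $R_{G\to\Lambda}$ of the same degree. Then the binomial $m-n$ is in $I_{G\to\Lambda}$ if and only if $d_v(m)=d_v(n)$ for all vertices $v$ of $G$.
   Context: Graphs are finite and undirected without multiple edges; loops are allowed. $\mathrm{Hom}(G,H)$ is the set of graph homomorphisms, i.e. maps $\phi:V(G)\to V(H)$ with $\phi(u)\phi(v)\in E(H)$ whenever $uv\in E(G)$. Fix a field $\mathbf{k}$. For $e\in E(G)$ let $G[e]$ be the subgraph consisting only of $e$ and its endpoint(s). Put $R_{G\to H}=\mathbf{k}[r_\phi : \phi\in\mathrm{Hom}(G,H)]$ and $S_{G\to H}=\mathbf{k}[s_\psi : e\in E(G),\ \psi\in \mathrm{Hom}(G[e],H)]$. Let $\Phi_{G\to H}:R_{G\to H}\to S_{G\to H}$ be the $\mathbf{k}$-algebra map with $\Phi(r_\phi)=\prod_{e\in E(G)} s_{\phi|_e}$, and $I_{G\to H}=\ker\Phi_{G\to H}$. $\Lambda$ is the graph with two vertices joined by an edge and with a loop at exactly one of the two vertices. Elements of $\mathrm{Hom}(G,\Lambda)$ correspond bijectively to independent sets $S$ of $G$ ($S$ is the preimage of the unlooped vertex); the corresponding variable is $r_S$. For a vertex $v$, $d_v(r_S)=1$ if $v\in S$ and $0$ otherwise, and $d_v(r_{S_1}\cdots r_{S_k})=d_v(r_{S_1})+\cdots+d_v(r_{S_k})$.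
   Formalization: The "only if" direction is stated only for graphs G in which every vertex lies on an edge or loop; with an isolated vertex v it fails, since r_{v} - r_∅ is in the ideal but d_v differs. The "if" direction is stated for all G. *)

theory Defs
  imports Complex_Main "HOL-Library.Poly_Mapping" "HOL-Library.FuncSet"
begin

section \<open>Graphs and homomorphisms\<close>

record 'a ugraph =
  verts :: "'a set"
  edges :: "'a set set"

text \<open>The edge \<open>uv\<close> is the set \<open>{u, v}\<close>; a loop at \<open>v\<close> is the singleton \<open>{v}\<close>.\<close>

definition is_ugraph :: "'a ugraph \<Rightarrow> bool" where
  "is_ugraph G \<longleftrightarrow> finite (verts G) \<and>
     (\<forall>e\<in>edges G. \<exists>u\<in>verts G. \<exists>v\<in>verts G. e = {u, v})"

text \<open>Homomorphisms are extensional functions, so that equality of homomorphisms is equality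
  on the vertices of \<open>G\<close>.\<close>

definition Hom :: "'a ugraph \<Rightarrow> 'b ugraph \<Rightarrow> ('a \<Rightarrow> 'b) set" where
  "Hom G H = {\<phi> \<in> verts G \<rightarrow>\<^sub>E verts H. \<forall>u v. {u, v} \<in> edges G \<longrightarrow> {\<phi> u, \<phi> v} \<in> edges H}"

definition edge_subgraph :: "'a set \<Rightarrow> 'a ugraph" where
  "edge_subgraph e = \<lparr>verts = e, edges = {e}\<rparr>"


section \<open>Polynomial rings\<close>

text \<open>An element of \<open>('x, 'k) mpoly\<close> maps exponent vectors to coefficients; its product is the
  convolution product of \<open>HOL-Library.Poly_Mapping\<close>.  A monomial is identified with its exponent
  vector.\<close>

type_synonym 'x mono = "'x \<Rightarrow>\<^sub>0 nat"
type_synonym ('x, 'k) mpoly = "'x mono \<Rightarrow>\<^sub>0 'k"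

definition monomials :: "'x set \<Rightarrow> 'x mono set" where
  "monomials X = {m. Poly_Mapping.keys m \<subseteq> X}"

definition poly_ring :: "'x set \<Rightarrow> ('x, 'k::field) mpoly set" where
  "poly_ring X = {p. Poly_Mapping.keys p \<subseteq> monomials X}"

definition mono_poly :: "'x mono \<Rightarrow> ('x, 'k::field) mpoly" where
  "mono_poly m = Poly_Mapping.single m 1"

definition Var :: "'x \<Rightarrow> ('x, 'k::field) mpoly" where
  "Var x = mono_poly (Poly_Mapping.single x 1)"

definition Const :: "'k \<Rightarrow> ('x, 'k::field) mpoly" where
  "Const c = Poly_Mapping.single 0 c"

definition mono_degree :: "'x mono \<Rightarrow> nat" where
  "mono_degree m = (\<Sum>x\<in>Poly_Mapping.keys m. Poly_Mapping.lookup m x)"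

text \<open>\<open>poly_subst f\<close> is the algebra map that substitutes \<open>f x\<close> for the variable \<open>x\<close>;
  see \<open>poly_subst_Var\<close> through \<open>poly_subst_mult\<close> below.\<close>

definition mono_subst :: "('x \<Rightarrow> ('y, 'k) mpoly) \<Rightarrow> 'x mono \<Rightarrow> ('y, 'k::field) mpoly" where
  "mono_subst f m = (\<Prod>x\<in>Poly_Mapping.keys m. f x ^ Poly_Mapping.lookup m x)"

definition poly_subst :: "('x \<Rightarrow> ('y, 'k) mpoly) \<Rightarrow> ('x, 'k) mpoly \<Rightarrow> ('y, 'k::field) mpoly" where
  "poly_subst f p =
     (\<Sum>m\<in>Poly_Mapping.keys p. Const (Poly_Mapping.lookup p m) * mono_subst f m)"


section \<open>The ideal of a pair of graphs\<close>

definition R_ring :: "'a ugraph \<Rightarrow> 'b ugraph \<Rightarrow> ('a \<Rightarrow> 'b, 'k::field) mpoly set" where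
  "R_ring G H = poly_ring (Hom G H)"

text \<open>The variable \<open>s\<^sub>\<psi>\<close> with \<open>\<psi> \<in> Hom(G[e], H)\<close> is indexed by the pair \<open>(e, \<psi>)\<close>, because an
  extensional function does not determine its domain.\<close>

definition S_vars :: "'a ugraph \<Rightarrow> 'b ugraph \<Rightarrow> ('a set \<times> ('a \<Rightarrow> 'b)) set" where
  "S_vars G H = (SIGMA e:edges G. Hom (edge_subgraph e) H)"

definition S_ring ::
    "'a ugraph \<Rightarrow> 'b ugraph \<Rightarrow> ('a set \<times> ('a \<Rightarrow> 'b), 'k::field) mpoly set" where
  "S_ring G H = poly_ring (S_vars G H)"

text \<open>\<open>Hom_map G\<close> is defined on the whole type; as a map from \<open>R_ring G H\<close> it has values
  in \<open>S_ring G H\<close>, see \<open>Hom_map_in_S_ring\<close>.\<close>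

definition Hom_map ::
    "'a ugraph \<Rightarrow> ('a \<Rightarrow> 'b, 'k::field) mpoly \<Rightarrow> ('a set \<times> ('a \<Rightarrow> 'b), 'k) mpoly" where
  "Hom_map G = poly_subst (\<lambda>\<phi>. \<Prod>e\<in>edges G. Var (e, restrict \<phi> e))"

definition Hom_ideal :: "'a ugraph \<Rightarrow> 'b ugraph \<Rightarrow> ('a \<Rightarrow> 'b, 'k::field) mpoly set" where
  "Hom_ideal G H = {p \<in> R_ring G H. Hom_map G p = 0}"


section \<open>Independent sets\<close>

datatype lam_vertex = Looped | Unlooped

definition Lam :: "lam_vertex ugraph" where
  "Lam = \<lparr>verts = {Looped, Unlooped}, edges = {{Looped}, {Looped, Unlooped}}\<rparr>"

definition indep_set :: "'a ugraph \<Rightarrow> ('a \<Rightarrow> lam_vertex) \<Rightarrow> 'a set" where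
  "indep_set G \<phi> = {v \<in> verts G. \<phi> v = Unlooped}"

definition var_deg :: "'a ugraph \<Rightarrow> 'a \<Rightarrow> ('a \<Rightarrow> lam_vertex) \<Rightarrow> nat" where
  "var_deg G v \<phi> = (if v \<in> indep_set G \<phi> then 1 else 0)"

definition vertex_deg :: "'a ugraph \<Rightarrow> 'a \<Rightarrow> ('a \<Rightarrow> lam_vertex) mono \<Rightarrow> nat" where
  "vertex_deg G v m = (\<Sum>\<phi>\<in>Poly_Mapping.keys m. Poly_Mapping.lookup m \<phi> * var_deg G v \<phi>)"

text \<open>If no edge contains \<open>v\<close>, the variable map does not depend on the value at \<open>v\<close>, so membership of
  \<open>m - n\<close> in the ideal does not force \<open>d\<^sub>v(m) = d\<^sub>v(n)\<close>; see \<open>isolated_vertex_counterexample\<close>.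
  A vertex with a loop is not isolated.\<close>

definition no_isolated :: "'a ugraph \<Rightarrow> bool" where
  "no_isolated G \<longleftrightarrow> (\<forall>v\<in>verts G. \<exists>e\<in>edges G. v \<in> e)"


section \<open>The substitution map is an algebra map\<close>

lemma Const_0 [simp]: "Const 0 = 0"
  by (simp add: Const_def)

lemma Const_add: "Const (a + b) = Const a + Const b"
  by (simp add: Const_def single_add)

lemma Const_mult: "Const (a * b) = Const a * Const b"
  by (simp add: Const_def mult_single)

lemma mono_subst_superset:
  assumes "finite A" "Poly_Mapping.keys m \<subseteq> A"
  shows "mono_subst f m = (\<Prod>x\<in>A. f x ^ Poly_Mapping.lookup m x)"
  unfolding mono_subst_def using assms
  by (intro prod.mono_neutral_left) (auto simp: in_keys_iff)

lemma mono_subst_add: "mono_subst f (m + n) = mono_subst f m * mono_subst f n"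
proof -
  let ?A = "Poly_Mapping.keys m \<union> Poly_Mapping.keys n"
  have "Poly_Mapping.keys (m + n) \<subseteq> ?A"
    by (rule Poly_Mapping.keys_add)
  then have "mono_subst f (m + n) = (\<Prod>x\<in>?A. f x ^ Poly_Mapping.lookup (m + n) x)"
    by (intro mono_subst_superset) auto
  also have "\<dots> = (\<Prod>x\<in>?A. f x ^ Poly_Mapping.lookup m x) * (\<Prod>x\<in>?A. f x ^ Poly_Mapping.lookup n x)"
    by (simp add: lookup_add power_add prod.distrib)
  also have "\<dots> = mono_subst f m * mono_subst f n"
    using mono_subst_superset[of ?A m f] mono_subst_superset[of ?A n f] by simp
  finally show ?thesis .
qed

lemma poly_subst_superset:
  assumes "finite A" "Poly_Mapping.keys p \<subseteq> A"
  shows "poly_subst f p = (\<Sum>m\<in>A. Const (Poly_Mapping.lookup p m) * mono_subst f m)"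
  unfolding poly_subst_def using assms
  by (intro sum.mono_neutral_left) (auto simp: in_keys_iff)

lemma poly_subst_0 [simp]: "poly_subst f 0 = 0"
  by (simp add: poly_subst_def)

lemma poly_subst_single: "poly_subst f (Poly_Mapping.single m c) = Const c * mono_subst f m"
  by (cases "c = 0") (simp_all add: poly_subst_def)

lemma poly_subst_Var: "poly_subst f (Var x) = f x"
  by (simp add: Var_def mono_poly_def poly_subst_single mono_subst_def Const_def)

lemma poly_subst_Const: "poly_subst f (Const c) = Const c"
  by (subst (1) Const_def) (simp add: poly_subst_single mono_subst_def)

lemma poly_subst_add: "poly_subst f (p + q) = poly_subst f p + poly_subst f q"
proof -
  let ?A = "Poly_Mapping.keys p \<union> Poly_Mapping.keys q"
  have "Poly_Mapping.keys (p + q) \<subseteq> ?A"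
    by (rule Poly_Mapping.keys_add)
  then have "poly_subst f (p + q) = (\<Sum>m\<in>?A. Const (Poly_Mapping.lookup (p + q) m) * mono_subst f m)"
    by (intro poly_subst_superset) auto
  also have "\<dots> = (\<Sum>m\<in>?A. Const (Poly_Mapping.lookup p m) * mono_subst f m) +
      (\<Sum>m\<in>?A. Const (Poly_Mapping.lookup q m) * mono_subst f m)"
    by (simp add: lookup_add Const_add distrib_right sum.distrib)
  also have "\<dots> = poly_subst f p + poly_subst f q"
    using poly_subst_superset[of ?A p f] poly_subst_superset[of ?A q f] by simp
  finally show ?thesis .
qed

lemma poly_mapping_single_induct [case_names zero add]:
  assumes "P 0" and "\<And>p m c. P p \<Longrightarrow> P (p + Poly_Mapping.single m c)"
  shows "P p"
proof (induction p rule: update_induct)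
  case const
  then show ?case by (simp add: assms(1))
next
  case (update f a b)
  have "Poly_Mapping.update a b f = f + Poly_Mapping.single a b"
    using update by (intro poly_mapping_eqI)
      (auto simp: lookup_update lookup_add lookup_single when_def in_keys_iff)
  with update assms(2) show ?case by simp
qed

lemma poly_subst_mult: "poly_subst f (p * q) = poly_subst f p * poly_subst f q"
proof (induction p rule: poly_mapping_single_induct)
  case zero
  then show ?case by simp
next
  case (add p m c)
  have "poly_subst f (Poly_Mapping.single m c * q) = poly_subst f (Poly_Mapping.single m c) * poly_subst f q"
  proof (induction q rule: poly_mapping_single_induct)
    case zero
    then show ?case by simp
  next
    case (add q n d)
    then show ?case
      by (simp add: distrib_left poly_subst_add mult_single poly_subst_single
          mono_subst_add Const_mult mult_ac)
  qed
  with add show ?case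
    by (simp add: distrib_right poly_subst_add)
qed


section \<open>The map of a pair of graphs has values in the target ring\<close>

lemma poly_ring_0: "0 \<in> poly_ring X"
  by (simp add: poly_ring_def)

lemma poly_ring_Const: "Const c \<in> poly_ring X"
  by (simp add: poly_ring_def monomials_def Const_def)

lemma poly_ring_Var: "x \<in> X \<Longrightarrow> Var x \<in> poly_ring X"
  by (simp add: poly_ring_def monomials_def Var_def mono_poly_def)

lemma poly_ring_add: "p \<in> poly_ring X \<Longrightarrow> q \<in> poly_ring X \<Longrightarrow> p + q \<in> poly_ring X"
  using Poly_Mapping.keys_add[of p q] by (auto simp: poly_ring_def)

lemma monomials_add: "m \<in> monomials X \<Longrightarrow> n \<in> monomials X \<Longrightarrow> m + n \<in> monomials X"
  using Poly_Mapping.keys_add[of m n] by (auto simp: monomials_def)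

lemma poly_ring_mult: "p \<in> poly_ring X \<Longrightarrow> q \<in> poly_ring X \<Longrightarrow> p * q \<in> poly_ring X"
  using keys_mult[of p q] by (fastforce simp: poly_ring_def intro: monomials_add)

lemma poly_ring_1: "1 \<in> poly_ring X"
  using poly_ring_Const[of 1 X] by (simp add: Const_def)

lemma poly_ring_power: "p \<in> poly_ring X \<Longrightarrow> p ^ k \<in> poly_ring X"
  by (induction k) (auto intro: poly_ring_1 poly_ring_mult)

lemma poly_ring_prod: "(\<And>i. i \<in> A \<Longrightarrow> f i \<in> poly_ring X) \<Longrightarrow> prod f A \<in> poly_ring X"
  by (induction A rule: infinite_finite_induct) (auto intro: poly_ring_1 poly_ring_mult)

lemma poly_ring_sum: "(\<And>i. i \<in> A \<Longrightarrow> f i \<in> poly_ring X) \<Longrightarrow> sum f A \<in> poly_ring X"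
  by (induction A rule: infinite_finite_induct) (auto intro: poly_ring_0 poly_ring_add)

lemma restrict_in_Hom_edge:
  assumes "is_ugraph G" "\<phi> \<in> Hom G H" "e \<in> edges G"
  shows "restrict \<phi> e \<in> Hom (edge_subgraph e) H"
proof -
  have "e \<subseteq> verts G"
    using assms(1,3) by (auto simp: is_ugraph_def)
  with assms(2,3) show ?thesis
    by (auto simp: Hom_def edge_subgraph_def PiE_iff)
qed

lemma Hom_map_Var: "Hom_map G (Var \<phi>) = (\<Prod>e\<in>edges G. Var (e, restrict \<phi> e))"
  by (simp add: Hom_map_def poly_subst_Var)

lemma Hom_map_in_S_ring:
  assumes "is_ugraph G" "p \<in> R_ring G H"
  shows "Hom_map G p \<in> S_ring G H"
  unfolding Hom_map_def poly_subst_def mono_subst_def S_ring_def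
proof (intro poly_ring_sum poly_ring_mult poly_ring_Const poly_ring_prod poly_ring_power
    poly_ring_Var)
  fix m \<phi> e
  assume "m \<in> Poly_Mapping.keys p" "\<phi> \<in> Poly_Mapping.keys m" "e \<in> edges G"
  then show "(e, restrict \<phi> e) \<in> S_vars G H"
    using assms restrict_in_Hom_edge[of G \<phi> H e]
    by (auto simp: R_ring_def poly_ring_def monomials_def S_vars_def)
qed


section \<open>Isolated vertices\<close>

lemma isolated_vertex_counterexample:
  fixes v :: 'a
  defines "G \<equiv> \<lparr>verts = {v}, edges = {}\<rparr> :: 'a ugraph"
  defines "m \<equiv> Poly_Mapping.single (\<lambda>x\<in>{v}. Unlooped) 1 :: ('a \<Rightarrow> lam_vertex) mono"
  defines "n \<equiv> Poly_Mapping.single (\<lambda>x\<in>{v}. Looped) 1 :: ('a \<Rightarrow> lam_vertex) mono"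
  shows "is_ugraph G" "m \<in> monomials (Hom G Lam)" "n \<in> monomials (Hom G Lam)"
    "mono_degree m = mono_degree n"
    "mono_poly m - mono_poly n \<in> (Hom_ideal G Lam :: ('a \<Rightarrow> lam_vertex, 'k::field) mpoly set)"
    "vertex_deg G v m \<noteq> vertex_deg G v n"
proof -
  show G: "is_ugraph G"
    by (simp add: G_def is_ugraph_def)
  show m: "m \<in> monomials (Hom G Lam)" and n: "n \<in> monomials (Hom G Lam)"
    by (auto simp: m_def n_def monomials_def Hom_def G_def Lam_def)
  show "mono_degree m = mono_degree n"
    by (simp add: m_def n_def mono_degree_def)
  show "vertex_deg G v m \<noteq> vertex_deg G v n"
    by (simp add: m_def n_def vertex_deg_def var_deg_def indep_set_def G_def)
  have mn: "mono_poly m - mono_poly n =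
      (Var (\<lambda>x\<in>{v}. Unlooped) + Const (-1) * Var (\<lambda>x\<in>{v}. Looped) :: ('a \<Rightarrow> lam_vertex, 'k) mpoly)"
    by (simp add: m_def n_def Var_def Const_def mono_poly_def mult_single single_uminus)
  have "mono_poly m - mono_poly n \<in> (R_ring G Lam :: ('a \<Rightarrow> lam_vertex, 'k) mpoly set)"
    unfolding mn R_ring_def using m n
    by (intro poly_ring_add poly_ring_mult poly_ring_Const poly_ring_Var)
      (auto simp: m_def n_def monomials_def)
  moreover have "Hom_map G (mono_poly m - mono_poly n :: ('a \<Rightarrow> lam_vertex, 'k) mpoly) = 0"
    unfolding mn Hom_map_def
    by (simp add: poly_subst_add poly_subst_mult poly_subst_Var poly_subst_Const G_def)
      (simp add: Const_def single_uminus)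
  ultimately show "mono_poly m - mono_poly n \<in> (Hom_ideal G Lam :: ('a \<Rightarrow> lam_vertex, 'k) mpoly set)"
    by (simp add: Hom_ideal_def)
qed

end

theory Submission
  imports Defs
begin

text \<open>The variable map sends the monomial \<open>m\<close> to the monomial in which \<open>s\<^bsub>(e, \<psi>)\<^esub>\<close> has as exponent
  the number of factors \<open>r\<^sub>\<phi>\<close> of \<open>m\<close> with \<open>\<phi>|\<^sub>e = \<psi>\<close>, so \<open>m - n\<close> lies in the ideal iff these
  numbers agree for \<open>m\<close> and \<open>n\<close>.  A homomorphism to \<open>\<Lambda>\<close> sends at most one vertex of an edge \<open>e\<close> to
  the unlooped vertex.  If this vertex is \<open>v\<close>, the number is \<open>d\<^sub>v(m)\<close>; the restrictions with no
  such vertex are counted by \<open>deg m - (\<Sum>v\<in>e. d\<^sub>v(m))\<close>.\<close>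

lemma mono_poly_mult: "mono_poly m * mono_poly n = mono_poly (m + n)"
  by (simp add: mono_poly_def mult_single)

lemma mono_poly_prod: "(\<Prod>i\<in>A. mono_poly (f i)) = mono_poly (\<Sum>i\<in>A. f i)"
  by (induction A rule: infinite_finite_induct) (simp_all add: mono_poly_mult, simp_all add: mono_poly_def)

text \<open>The multiple of \<open>m\<close> by \<open>k\<close> is kept as a sum of
  \<open>k\<close> copies, so powers become a case of \<open>mono_poly_prod\<close> and
  \<open>lookup_sum\<close> can evaluate the result.\<close>

lemma mono_poly_power: "mono_poly m ^ k = mono_poly (\<Sum>i<k. m)"
  using mono_poly_prod[of "\<lambda>_. m" "{..<k}"] by simp

lemma mono_poly_inject:
  "(mono_poly m :: ('x, 'k::field) mpoly) = mono_poly n \<longleftrightarrow> m = n"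
proof
  assume "(mono_poly m :: ('x, 'k) mpoly) = mono_poly n"
  then have "Poly_Mapping.keys (mono_poly m :: ('x, 'k) mpoly) = Poly_Mapping.keys (mono_poly n :: ('x, 'k) mpoly)"
    by simp
  then show "m = n"
    by (simp add: mono_poly_def)
qed simp

lemma mono_subst_mono_poly:
  "mono_subst (\<lambda>x. mono_poly (f x)) m =
    mono_poly (\<Sum>x\<in>Poly_Mapping.keys m. \<Sum>i<Poly_Mapping.lookup m x. f x)"
  by (simp add: mono_subst_def mono_poly_power mono_poly_prod)

lemma poly_subst_mono_poly: "poly_subst f (mono_poly m) = mono_subst f m"
  unfolding mono_poly_def poly_subst_single by (simp add: Const_def)

lemma poly_subst_diff: "poly_subst f (p - q) = poly_subst f p - poly_subst f q"
  using poly_subst_add[of f "p - q" q] by simp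

text \<open>The exponent vector of the image of \<open>m\<close>, in the shape that
  \<open>mono_subst_mono_poly\<close> produces: the sum over \<open>i\<close> counts each variable
  with its multiplicity.\<close>

definition edge_exponents ::
    "'a ugraph \<Rightarrow> ('a \<Rightarrow> 'b) mono \<Rightarrow> ('a set \<times> ('a \<Rightarrow> 'b)) mono" where
  "edge_exponents G m = (\<Sum>\<phi>\<in>Poly_Mapping.keys m. \<Sum>i<Poly_Mapping.lookup m \<phi>.
     \<Sum>e\<in>edges G. Poly_Mapping.single (e, restrict \<phi> e) 1)"

lemma Hom_map_mono_poly: "Hom_map G (mono_poly m) = mono_poly (edge_exponents G m)"
  by (simp add: Hom_map_def Var_def mono_poly_prod poly_subst_mono_poly mono_subst_mono_poly
      edge_exponents_def)

lemma mono_poly_diff_in_Hom_ideal_iff: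
  assumes "m \<in> monomials (Hom G H)" "n \<in> monomials (Hom G H)"
  shows "mono_poly m - mono_poly n \<in> (Hom_ideal G H :: ('a \<Rightarrow> 'b, 'k::field) mpoly set) \<longleftrightarrow>
    edge_exponents G m = edge_exponents G n"
proof -
  \<comment> \<open>Only an inclusion: for \<open>m = n\<close> the difference has no keys.\<close>
  have "Poly_Mapping.keys (mono_poly m - mono_poly n :: ('a \<Rightarrow> 'b, 'k) mpoly) \<subseteq> {m, n}"
    using keys_diff[of "mono_poly m :: ('a \<Rightarrow> 'b, 'k) mpoly" "mono_poly n"]
    by (auto simp: mono_poly_def)
  with assms have "mono_poly m - mono_poly n \<in> (R_ring G H :: ('a \<Rightarrow> 'b, 'k) mpoly set)"
    by (auto simp: R_ring_def poly_ring_def)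
  moreover have "Hom_map G (mono_poly m - mono_poly n :: ('a \<Rightarrow> 'b, 'k) mpoly) =
      mono_poly (edge_exponents G m) - mono_poly (edge_exponents G n)"
    unfolding Hom_map_mono_poly[symmetric] by (simp add: Hom_map_def poly_subst_diff)
  ultimately show ?thesis
    by (simp add: Hom_ideal_def mono_poly_inject)
qed

lemma finite_edges: "is_ugraph G \<Longrightarrow> finite (edges G)"
  by (rule finite_subset[of _ "Pow (verts G)"]) (auto simp: is_ugraph_def)

lemma lookup_edge_exponents:
  assumes "is_ugraph G"
  shows "Poly_Mapping.lookup (edge_exponents G m) (e, \<psi>) =
    (if e \<in> edges G
     then \<Sum>\<phi>\<in>Poly_Mapping.keys m. Poly_Mapping.lookup m \<phi> * of_bool (restrict \<phi> e = \<psi>) else 0)"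
proof -
  have "(\<Sum>e'\<in>edges G. Poly_Mapping.lookup (Poly_Mapping.single (e', restrict \<phi> e') 1) (e, \<psi>)) =
      (of_bool (e \<in> edges G \<and> restrict \<phi> e = \<psi>) :: nat)" for \<phi>
  proof -
    \<comment> \<open>The index of a variable records its edge, so only the summand for
      \<open>e\<close> itself can contribute.\<close>
    have "(\<Sum>e'\<in>edges G. Poly_Mapping.lookup (Poly_Mapping.single (e', restrict \<phi> e') 1) (e, \<psi>)) =
        (\<Sum>e'\<in>edges G. if e = e' then of_bool (restrict \<phi> e = \<psi>) else (0::nat))"
      by (intro sum.cong) (auto simp: lookup_single when_def)
    then show ?thesis
      using finite_edges[OF assms] by simp
  qed
  then show ?thesis
    by (simp add: edge_exponents_def lookup_sum)
qed

lemma edge_subset_verts: "is_ugraph G \<Longrightarrow> e \<in> edges G \<Longrightarrow> e \<subseteq> verts G"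
  by (auto simp: is_ugraph_def)

text \<open>Two distinct unlooped vertices on \<open>e\<close> would be its two endpoints, and their
  image would be a loop at \<open>Unlooped\<close>, which \<open>Lam\<close> does not have.\<close>

lemma Hom_Lam_edge_unique:
  assumes "is_ugraph G" "\<phi> \<in> Hom G Lam" "e \<in> edges G" "u \<in> e" "v \<in> e"
    and "\<phi> u = Unlooped" "\<phi> v = Unlooped"
  shows "u = v"
proof (rule ccontr)
  assume "u \<noteq> v"
  with assms have "e = {u, v}"
    by (auto simp: is_ugraph_def)
  with assms have "{\<phi> u, \<phi> v} \<in> edges Lam"
    unfolding Hom_def by blast
  with assms(6,7) show False
    by (auto simp: Lam_def)
qed

text \<open>If \<open>e\<close> is a loop at \<open>v\<close>, this is not a homomorphism. Its
  exponent is then 0, in agreement with \<open>vertex_deg G v m\<close>, because homomorphisms to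
  \<open>Lam\<close> send looped vertices to \<open>Looped\<close>.\<close>

definition unlooped_at :: "'a set \<Rightarrow> 'a \<Rightarrow> 'a \<Rightarrow> lam_vertex" where
  "unlooped_at e v = (\<lambda>w\<in>e. if w = v then Unlooped else Looped)"

lemma restrict_eq_unlooped_at_iff:
  assumes "is_ugraph G" "\<phi> \<in> Hom G Lam" "e \<in> edges G" "v \<in> e"
  shows "restrict \<phi> e = unlooped_at e v \<longleftrightarrow> \<phi> v = Unlooped"
proof
  assume "restrict \<phi> e = unlooped_at e v"
  then show "\<phi> v = Unlooped"
    using assms(4) by (auto simp: unlooped_at_def dest: fun_cong[of _ _ v])
next
  assume v: "\<phi> v = Unlooped"
  have "\<phi> w = (if w = v then Unlooped else Looped)" if "w \<in> e" for w
    using Hom_Lam_edge_unique[OF assms(1-3) that assms(4) _ v] v lam_vertex.exhaust by metis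
  then show "restrict \<phi> e = unlooped_at e v"
    unfolding unlooped_at_def by (rule restrict_ext)
qed

lemma lookup_edge_exponents_unlooped_at:
  assumes "is_ugraph G" "m \<in> monomials (Hom G Lam)" "e \<in> edges G" "v \<in> e"
  shows "Poly_Mapping.lookup (edge_exponents G m) (e, unlooped_at e v) = vertex_deg G v m"
  unfolding lookup_edge_exponents[OF assms(1)] vertex_deg_def
proof (simp only: assms(3) if_True, rule sum.cong[OF refl])
  fix \<phi> assume "\<phi> \<in> Poly_Mapping.keys m"
  then have "\<phi> \<in> Hom G Lam"
    using assms(2) by (auto simp: monomials_def)
  then show "Poly_Mapping.lookup m \<phi> * of_bool (restrict \<phi> e = unlooped_at e v) =
      Poly_Mapping.lookup m \<phi> * var_deg G v \<phi>"
    using restrict_eq_unlooped_at_iff[OF assms(1) _ assms(3,4)] edge_subset_verts[OF assms(1,3)] assms(4)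
    by (auto simp: var_deg_def indep_set_def)
qed

text \<open>On \<open>e\<close>, each factor of \<open>m\<close> is either constantly
  \<open>Looped\<close> or has exactly one unlooped vertex, so it contributes 1 to the left side in
  both cases. The additive form avoids truncated subtraction on \<open>nat\<close>.\<close>

lemma lookup_edge_exponents_Looped:
  assumes "is_ugraph G" "m \<in> monomials (Hom G Lam)" "e \<in> edges G"
  shows "Poly_Mapping.lookup (edge_exponents G m) (e, \<lambda>w\<in>e. Looped) + (\<Sum>v\<in>e. vertex_deg G v m) =
    mono_degree m"
proof -
  have fin: "finite e"
    using assms(1,3) by (auto simp: is_ugraph_def)
  have partition: "of_bool (restrict \<phi> e = (\<lambda>w\<in>e. Looped)) + (\<Sum>v\<in>e. var_deg G v \<phi>) = 1"
    if \<phi>: "\<phi> \<in> Hom G Lam" for \<phi>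
  proof (cases "\<exists>v\<in>e. \<phi> v = Unlooped")
    case True
    then obtain v where v: "v \<in> e" "\<phi> v = Unlooped"
      by blast
    have "var_deg G w \<phi> = (if w = v then 1 else 0)" if w: "w \<in> e" for w
    proof -
      have "\<phi> w = Unlooped \<longleftrightarrow> w = v"
        using Hom_Lam_edge_unique[OF assms(1) \<phi> assms(3) w v(1) _ v(2)] v by blast
      then show ?thesis
        using w edge_subset_verts[OF assms(1,3)] by (auto simp: var_deg_def indep_set_def)
    qed
    then have "(\<Sum>w\<in>e. var_deg G w \<phi>) = 1"
      using fin v by simp
    moreover have "restrict \<phi> e \<noteq> (\<lambda>w\<in>e. Looped)"
      using v by (auto dest: fun_cong[of _ _ v])
    ultimately show ?thesis by simp
  next
    case False
    then have "restrict \<phi> e = (\<lambda>w\<in>e. Looped)"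
      by (intro restrict_ext) (metis lam_vertex.exhaust)
    moreover have "(\<Sum>w\<in>e. var_deg G w \<phi>) = 0"
      using False by (auto simp: var_deg_def indep_set_def)
    ultimately show ?thesis by simp
  qed
  \<comment> \<open>Exchanging the sums collects the contributions of each factor, to which
    \<open>partition\<close> applies.\<close>
  have "(\<Sum>v\<in>e. vertex_deg G v m) =
      (\<Sum>\<phi>\<in>Poly_Mapping.keys m. Poly_Mapping.lookup m \<phi> * (\<Sum>v\<in>e. var_deg G v \<phi>))"
    unfolding vertex_deg_def by (subst sum.swap) (simp add: sum_distrib_left)
  then have "Poly_Mapping.lookup (edge_exponents G m) (e, \<lambda>w\<in>e. Looped) + (\<Sum>v\<in>e. vertex_deg G v m) =
      (\<Sum>\<phi>\<in>Poly_Mapping.keys m. Poly_Mapping.lookup m \<phi> *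
        (of_bool (restrict \<phi> e = (\<lambda>w\<in>e. Looped)) + (\<Sum>v\<in>e. var_deg G v \<phi>)))"
    using assms(3) by (simp only: lookup_edge_exponents[OF assms(1)] if_True sum.distrib distrib_left)
  also have "\<dots> = mono_degree m"
    using assms(2) partition by (auto simp: mono_degree_def monomials_def subset_iff intro!: sum.cong)
  finally show ?thesis .
qed

text \<open>A homomorphism to \<open>Lam\<close> restricts to an edge in one of the two excluded
  forms. Both exclusions are conditional on \<open>e\<close> being an edge, so the lemma also covers
  indices whose first component is not an edge.\<close>

lemma lookup_edge_exponents_eq_0:
  assumes "is_ugraph G" "m \<in> monomials (Hom G Lam)"
    and "e \<in> edges G \<Longrightarrow> \<psi> \<noteq> (\<lambda>w\<in>e. Looped)"
    and "\<And>v. e \<in> edges G \<Longrightarrow> v \<in> e \<Longrightarrow> \<psi> \<noteq> unlooped_at e v"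
  shows "Poly_Mapping.lookup (edge_exponents G m) (e, \<psi>) = 0"
proof -
  have "restrict \<phi> e \<noteq> \<psi>" if \<phi>: "\<phi> \<in> Hom G Lam" and e: "e \<in> edges G" for \<phi>
  proof (cases "\<exists>v\<in>e. \<phi> v = Unlooped")
    case True
    then show ?thesis
      using assms(4) restrict_eq_unlooped_at_iff[OF assms(1) \<phi> e] e by metis
  next
    case False
    then have "restrict \<phi> e = (\<lambda>w\<in>e. Looped)"
      by (intro restrict_ext) (metis lam_vertex.exhaust)
    then show ?thesis
      using assms(3) e by metis
  qed
  then show ?thesis
    using assms(2) by (auto simp: lookup_edge_exponents[OF assms(1)] monomials_def)
qed

lemma edge_exponents_eq_if_vertex_deg_eq:
  assumes G: "is_ugraph G"
    and m: "m \<in> monomials (Hom G Lam)" and n: "n \<in> monomials (Hom G Lam)"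
    and deg: "mono_degree m = mono_degree n"
    and vdeg: "\<And>v. v \<in> verts G \<Longrightarrow> vertex_deg G v m = vertex_deg G v n"
  shows "edge_exponents G m = edge_exponents G n"
proof (rule poly_mapping_eqI)
  fix k :: "'a set \<times> ('a \<Rightarrow> lam_vertex)"
  obtain e \<psi> where k: "k = (e, \<psi>)"
    by fastforce
  consider (looped) "e \<in> edges G" "\<psi> = (\<lambda>w\<in>e. Looped)"
    | (unlooped) v where "e \<in> edges G" "v \<in> e" "\<psi> = unlooped_at e v"
    | (none) "e \<in> edges G \<Longrightarrow> \<psi> \<noteq> (\<lambda>w\<in>e. Looped)"
        "\<And>v. e \<in> edges G \<Longrightarrow> v \<in> e \<Longrightarrow> \<psi> \<noteq> unlooped_at e v"
    by blast
  then show "Poly_Mapping.lookup (edge_exponents G m) k = Poly_Mapping.lookup (edge_exponents G n) k"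
  proof cases
    case looped
    \<comment> \<open>This is the case that uses \<open>deg\<close>: the exponent is the total
      degree minus this sum.\<close>
    have "(\<Sum>v\<in>e. vertex_deg G v m) = (\<Sum>v\<in>e. vertex_deg G v n)"
      using edge_subset_verts[OF G looped(1)] vdeg by (intro sum.cong) auto
    then show ?thesis
      using lookup_edge_exponents_Looped[OF G m looped(1)]
        lookup_edge_exponents_Looped[OF G n looped(1)] deg k looped(2) by simp
  next
    case unlooped
    then show ?thesis
      using lookup_edge_exponents_unlooped_at[OF G m unlooped(1,2)]
        lookup_edge_exponents_unlooped_at[OF G n unlooped(1,2)]
        edge_subset_verts[OF G unlooped(1)] vdeg k by auto
  next
    case none
    then show ?thesis
      using lookup_edge_exponents_eq_0[OF G m none] lookup_edge_exponents_eq_0[OF G n none] k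
      by simp
  qed
qed

theorem lemma7p1:
  fixes G :: "'a ugraph"
    and m n :: "('a \<Rightarrow> lam_vertex) mono"
  assumes "is_ugraph G"
    and "m \<in> monomials (Hom G Lam)"
    and "n \<in> monomials (Hom G Lam)"
    and "mono_degree m = mono_degree n"
  shows "(no_isolated G \<longrightarrow>
      (mono_poly m - mono_poly n \<in> (Hom_ideal G Lam :: ('a \<Rightarrow> lam_vertex, 'k::field) mpoly set)
        \<longleftrightarrow> (\<forall>v\<in>verts G. vertex_deg G v m = vertex_deg G v n)))
    \<and> ((\<forall>v\<in>verts G. vertex_deg G v m = vertex_deg G v n) \<longrightarrow>
      mono_poly m - mono_poly n \<in> (Hom_ideal G Lam :: ('a \<Rightarrow> lam_vertex, 'k) mpoly set))"
proof -
  have "vertex_deg G v m = vertex_deg G v n"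
    if iso: "no_isolated G" and eq: "edge_exponents G m = edge_exponents G n" and v: "v \<in> verts G" for v
  proof -
    \<comment> \<open>Any edge through \<open>v\<close> works: the exponent at
      \<open>(e, unlooped_at e v)\<close> recovers the degree at \<open>v\<close>.\<close>
    obtain e where "e \<in> edges G" "v \<in> e"
      using iso v by (auto simp: no_isolated_def)
    then show ?thesis
      using lookup_edge_exponents_unlooped_at[OF assms(1)] assms(2,3) eq by metis
  qed
  then show ?thesis
    using edge_exponents_eq_if_vertex_deg_eq[OF assms]
    unfolding mono_poly_diff_in_Hom_ideal_iff[OF assms(2,3)] by blast
qed

end
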